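(* Let $x$ and $s$ be positive integers, and for $k\ge 1$ let $$F_k(x,s):=\left[x,\frac{s}{x},x^2,\frac{s}{x^2},x^3,\frac{s}{x^3},\dots,x^k,\frac{s}{x^k}\right].$$ Then, as $k\to\infty$, $F_k(x,s)$ converges to the largest root (in $z$) of the polynomial $P(x,z,s)=sz^2-((s+1)x-1)z-x$.
   Context: For positive real numbers $b_0,b_1,\dots,b_n$, the notation $[b_0,b_1,\dots,b_n]$ denotes the finite continued fraction $b_0+\cfrac{1}{b_1+\cfrac{1}{b_2+\cdots+\cfrac{1}{b_n}}}$; the partial quotients $b_i$ need not be integers. Thus $F_k(x,s)$ has $2k$ partial quotients, alternating $x^i, s/x^i$ for $i=1,\dots,k$. *)

theory Defs
  imports Complex_Main "HOL-Computational_Algebra.Polynomial"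
begin

(* Meaningful for non-empty lists of positive numbers; the value for the empty list is a dummy. *)
fun cfrac :: "real list \<Rightarrow> real" where
  "cfrac [] = 0"
| "cfrac [b] = b"
| "cfrac (b # c # bs) = b + 1 / cfrac (c # bs)"

definition F_quotients :: "nat \<Rightarrow> nat \<Rightarrow> nat \<Rightarrow> real list" where
  "F_quotients k x s = concat (map (\<lambda>i. [real x ^ i, real s / real x ^ i]) [1..<Suc k])"

definition F :: "nat \<Rightarrow> nat \<Rightarrow> nat \<Rightarrow> real" where
  "F k x s = cfrac (F_quotients k x s)"

(* P(x, z, s) = s z^2 - ((s + 1) x - 1) z - x as a polynomial in z
   (coefficients listed from the constant term upwards). *)
definition P :: "nat \<Rightarrow> nat \<Rightarrow> real poly" where
  "P x s = [: - real x, - ((real s + 1) * real x - 1), real s :]"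

end

theory Submission
  imports Defs
begin

text \<open>
  Write the tail of the continued fraction that starts at \<open>x ^ (m + 1)\<close> as \<open>x ^ m * z\<close>.  Then \<open>z\<close>
  is obtained from the corresponding \<open>z'\<close> of the next tail by the map
  \<open>z = x * (1 + z' / (s * z' + 1))\<close>, which does not depend on \<open>m\<close>; so \<open>F\<close> is an orbit of this map.
  Its fixed points are the roots of \<open>P\<close>, and on \<open>[x, \<infinity>)\<close> it contracts by the factor
  \<open>x / (s * x + 1)^2 \<le> 1/4\<close>.
\<close>

lemma cfrac_Cons: "bs \<noteq> [] \<Longrightarrow> cfrac (b # bs) = b + 1 / cfrac bs"
  by (cases bs) auto

definition step :: "real \<Rightarrow> real \<Rightarrow> real \<Rightarrow> real" where
  "step x s z = x * (1 + z / (s * z + 1))"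

lemma step_ge:
  assumes "x > 0" "s > 0" "z \<ge> 0"
  shows "x \<le> step x s z"
  using assms by (simp add: step_def mult_le_cancel_left1)

lemma step_iterate_ge:
  assumes "x > 0" "s > 0" "z \<ge> x"
  shows "x \<le> (step x s ^^ n) z"
proof (induction n)
  case (Suc n)
  then show ?case using step_ge[OF assms(1,2)] assms(1) by simp
qed (use assms in simp)

text \<open>The starting value is the last pair of quotients,
  \<open>x ^ Suc m + x ^ Suc m / s\<close>, divided by \<open>x ^ m\<close>. Peeling off the first
  pair raises \<open>m\<close> by one, so the induction on \<open>n\<close> keeps \<open>m\<close>
  arbitrary.\<close>

lemma cfrac_tail_eq_step_iterate:
  fixes x s :: real
  assumes "x > 0" "s > 0"
  shows "cfrac (concat (map (\<lambda>i. [x ^ i, s / x ^ i]) [Suc m..<Suc (Suc (m + n))]))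
           = x ^ m * (step x s ^^ n) (x * (1 + 1 / s))"
proof (induction n arbitrary: m)
  case 0
  then show ?case using assms by (simp add: field_simps)
next
  case (Suc n)
  define w where "w = (step x s ^^ n) (x * (1 + 1 / s))"
  let ?t = "concat (map (\<lambda>i. [x ^ i, s / x ^ i]) [Suc (Suc m)..<Suc (Suc (Suc m + n))])"
  have "w \<ge> x"
    unfolding w_def using assms by (intro step_iterate_ge) (auto simp: field_simps)
  then have w: "w > 0" using assms by linarith
  have t: "cfrac ?t = x ^ Suc m * w"
    unfolding w_def by (rule Suc.IH)
  have ne: "?t \<noteq> []" by (simp add: upt_rec)
  have "cfrac (concat (map (\<lambda>i. [x ^ i, s / x ^ i]) [Suc m..<Suc (Suc (m + Suc n))]))
          = cfrac (x ^ Suc m # s / x ^ Suc m # ?t)"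
    by (subst upt_conv_Cons) simp_all
  also have "\<dots> = x ^ Suc m + 1 / (s / x ^ Suc m + 1 / (x ^ Suc m * w))"
    by (simp only: cfrac_Cons[OF ne] cfrac_Cons[OF list.distinct(2)] t)
  also have "s / x ^ Suc m + 1 / (x ^ Suc m * w) = (s * w + 1) / (x ^ Suc m * w)"
    using assms w by (simp add: field_simps)
  also have "x ^ Suc m + 1 / ((s * w + 1) / (x ^ Suc m * w)) = x ^ m * step x s w"
    by (simp add: step_def algebra_simps)
  finally show ?case by (simp add: w_def)
qed

text \<open>Of the \<open>Suc n\<close> pairs of quotients, the last gives the starting value and
  the other \<open>n\<close> give one step each. The index \<open>Suc n\<close> avoids
  \<open>F 0\<close>, the dummy value of the empty list.\<close>

lemma F_Suc_eq_step_iterate: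
  assumes "x > 0" "s > 0"
  shows "F (Suc n) x s = (step (real x) (real s) ^^ n) (real x * (1 + 1 / real s))"
  using cfrac_tail_eq_step_iterate[of "real x" "real s" 0 n] assms
  by (simp add: F_def F_quotients_def)

text \<open>The difference of the two values is \<open>x * (y - z) / D\<close>, where both factors
  of \<open>D\<close> are at least \<open>x + 1\<close>; then AM-GM gives
  \<open>(x + 1) * (x + 1) \<ge> 4 * x\<close>.\<close>

lemma step_contraction:
  assumes "x > 0" "s \<ge> 1" "y \<ge> x" "z \<ge> x"
  shows "\<bar>step x s y - step x s z\<bar> \<le> \<bar>y - z\<bar> / 4"
proof -
  define D where "D = (s * y + 1) * (s * z + 1)"
  have le: "x + 1 \<le> s * v + 1" if "v \<ge> x" for v
    using mult_mono[of 1 s x v] that assms by simp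
  have "4 * x \<le> (x + 1) * (x + 1)"
    using zero_le_square[of "x - 1"] by (simp add: algebra_simps)
  also have "\<dots> \<le> D"
    unfolding D_def using le assms by (intro mult_mono) (auto intro: order_trans[OF _ le])
  finally have D: "4 * x \<le> D" .
  have "s * y + 1 > 0" "s * z + 1 > 0"
    using le[of y] le[of z] assms by linarith+
  then have eq: "step x s y - step x s z = x / D * (y - z)"
    unfolding step_def D_def by (simp add: divide_simps) (simp add: algebra_simps)
  have "\<bar>x / D\<bar> \<le> 1 / 4"
    using D assms by (simp add: field_simps)
  from mult_right_mono[OF this abs_ge_zero[of "y - z"]] show ?thesis
    by (simp add: eq abs_mult)
qed

lemma step_iterate_tendsto_fixpoint:
  assumes "x > 0" "s \<ge> 1" "z \<ge> x" "r \<ge> x" "step x s r = r"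
  shows "(\<lambda>n. (step x s ^^ n) z) \<longlonglongrightarrow> r"
proof (rule LIM_zero_cancel, rule tendsto_0_le[where K = "\<bar>z - r\<bar>"])
  have "\<bar>(step x s ^^ n) z - r\<bar> \<le> (1 / 4) ^ n * \<bar>z - r\<bar>" for n
  proof (induction n)
    case (Suc n)
    have "\<bar>step x s ((step x s ^^ n) z) - step x s r\<bar> \<le> \<bar>(step x s ^^ n) z - r\<bar> / 4"
      using assms by (intro step_contraction step_iterate_ge) auto
    with Suc assms(5) show ?case by simp
  qed simp
  then show "\<forall>\<^sub>F n in sequentially. norm ((step x s ^^ n) z - r) \<le> norm ((1 / 4 :: real) ^ n) * \<bar>z - r\<bar>"
    by simp
  show "(\<lambda>n. (1 / 4 :: real) ^ n) \<longlonglongrightarrow> 0"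
    by (intro LIMSEQ_power_zero) simp
qed

lemma poly_P: "poly (P x s) z = real s * z\<^sup>2 - ((real s + 1) * real x - 1) * z - real x"
  by (simp add: P_def power2_eq_square algebra_simps)

lemma step_fixpoint_iff_root:
  assumes "s > 0" "z > 0"
  shows "step (real x) (real s) z = z \<longleftrightarrow> poly (P x s) z = 0"
proof -
  have "real s * z + 1 > 0" using assms by (intro add_nonneg_pos) auto
  then show ?thesis
    by (simp add: step_def poly_P field_simps power2_eq_square) (auto simp: algebra_simps)
qed

lemma positive_root_exists:
  assumes "x > 0" "s > 0"
  shows "\<exists>r>0. poly (P x s) r = 0"
proof -
  define b where "b = (real s + 1) * real x - 1"
  define d where "d = sqrt (b\<^sup>2 + 4 * real s * real x)"
  have d2: "d\<^sup>2 = b\<^sup>2 + 4 * real s * real x"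
    unfolding d_def by simp
  \<comment> \<open>Since \<open>sqrt (b\<^sup>2)\<close> is the absolute value of \<open>b\<close>,
    the sum \<open>b + d\<close> is positive whatever the sign of \<open>b\<close>.\<close>
  have "sqrt (b\<^sup>2) < d"
    unfolding d_def using assms by (intro real_sqrt_less_mono) simp
  then have "b + d > 0" by simp
  moreover have "poly (P x s) ((b + d) / (2 * real s)) = 0"
  proof -
    \<comment> \<open>Completing the square: \<open>4 * s * P(z) = (2 * s * z - b)\<^sup>2 -
      b\<^sup>2 - 4 * s * x\<close>, and here \<open>2 * s * z - b = d\<close>.\<close>
    have "4 * real s * poly (P x s) ((b + d) / (2 * real s)) = d\<^sup>2 - b\<^sup>2 - 4 * real s * real x"
      unfolding poly_P b_def[symmetric] using assms
      by (simp add: field_simps power2_eq_square)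
    then show ?thesis using d2 assms by simp
  qed
  ultimately show ?thesis using assms by (intro exI[of _ "(b + d) / (2 * real s)"]) simp
qed

lemma positive_root_greatest:
  assumes "s > 0" "r > 0" "poly (P x s) r = 0" "poly (P x s) z = 0"
  shows "z \<le> r"
proof (rule ccontr)
  assume "\<not> z \<le> r"
  then have zr: "z > r" by simp
  \<comment> \<open>Eliminating the linear coefficient: the product of two distinct roots is \<open>- x / s\<close>.\<close>
  have "(z - r) * (real s * (z * r) + real x) = r * poly (P x s) z - z * poly (P x s) r"
    unfolding poly_P by (simp add: algebra_simps power2_eq_square)
  moreover have "real s * (z * r) + real x > 0"
    using assms zr by (intro add_pos_nonneg mult_pos_pos) auto
  ultimately show False using assms zr by simp
qed

theorem theorem3:
  fixes x s :: nat
  assumes "x > 0" and "s > 0"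
  shows "\<exists>r. poly (P x s) r = 0 \<and> (\<forall>z. poly (P x s) z = 0 \<longrightarrow> z \<le> r) \<and>
             (\<lambda>k. F k x s) \<longlonglongrightarrow> r"
proof -
  obtain r where r: "r > 0" "poly (P x s) r = 0"
    using positive_root_exists[OF assms] by blast
  then have fix_r: "step (real x) (real s) r = r"
    using step_fixpoint_iff_root assms by blast
  \<comment> \<open>Being a value of \<open>step\<close> at a positive point, \<open>r\<close> lies
    in the region where the contraction bound holds.\<close>
  then have "r \<ge> real x"
    using step_ge[of "real x" "real s" r] r assms by simp
  then have "(\<lambda>n. F (Suc n) x s) \<longlonglongrightarrow> r"
    unfolding F_Suc_eq_step_iterate[OF assms] using assms fix_r
    by (intro step_iterate_tendsto_fixpoint) (auto simp: field_simps)
  then have "(\<lambda>k. F k x s) \<longlonglongrightarrow> r"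
    by (rule LIMSEQ_imp_Suc)
  then show ?thesis
    using r positive_root_greatest[OF assms(2)] by blast
qed

end
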